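(* For all integers $m,n\in\mathbf{Z}$ and every integer $c\geqslant 1$, $$S(m,n;c)=\sum_{d\mid (m,n,c)} d\, S\big(mnd^{-2},1;cd^{-1}\big),$$ where $S(\cdot,\cdot;\cdot)$ denotes the Kloosterman sum and the sum runs over all positive divisors $d$ of the greatest common divisor $(m,n,c)$.
   Context: For integers $m,n$ and an integer $c\geqslant 1$, the Kloosterman sum is $$S(m,n;c)=\sum_{\substack{a \bmod c\\ (a,c)=1}} \mathrm{e}\Big(\frac{ma+n\overline{a}}{c}\Big),$$ where $\mathrm{e}(x)=e^{2\pi i x}$, the sum is over residue classes $a$ modulo $c$ coprime to $c$, and $\overline{a}$ denotes an inverse of $a$ modulo $c$, i.e. $a\overline{a}\equiv 1 \pmod c$. For $c=1$ the sum has exactly one term, so $S(m,n;1)=1$. The notation $(m,n,c)$ means the (positive) greatest common divisor of $m,n,c$. For $d\mid (m,n,c)$, the numbers $mnd^{-2}=mn/d^2$ and $cd^{-1}=c/d$ are integers. *)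

theory Defs
  imports Complex_Main "HOL-Number_Theory.Number_Theory" "HOL-Number_Theory.Modular_Inverse"
begin

definition e2pi :: "real \<Rightarrow> complex" where
  "e2pi x = exp (2 * complex_of_real pi * \<i> * complex_of_real x)"

(* Intended for c >= 1. Residue classes mod c are represented by 0, ..., c - 1; for c = 1 the
   only representative is 0, which is coprime to 1. *)
definition kloosterman :: "int \<Rightarrow> int \<Rightarrow> int \<Rightarrow> complex" where
  "kloosterman m n c =
     (\<Sum>a | a \<in> {0..<c} \<and> coprime a c.
        e2pi (real_of_int (m * a + n * modular_inverse c a) / real_of_int c))"

lemma kloosterman_1: "kloosterman m n 1 = 1"
proof -
  have "{a. a \<in> {0..<1} \<and> coprime a 1} = {0::int}"
    by auto
  then show ?thesis
    by (simp add: kloosterman_def e2pi_def modular_inverse_def)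
qed

end

theory Submission
  imports Defs
begin

text \<open>
  Besides \<open>S(m,n;c)\<close> consider the sum \<open>T(m,n,k;c)\<close> of \<open>e((mx + ny)/c)\<close> over all pairs
  \<open>x, y\<close> modulo \<open>c\<close> with \<open>xy \<equiv> k\<close>. Detecting the congruence by additive characters shows
  that \<open>c T(m,n,k;c)\<close> is the sum of \<open>e((mx + ny + kt - txy)/c)\<close> over all \<open>x, y, t\<close>,
  so \<open>T\<close> is symmetric in \<open>m, n, k\<close>. Sorting the pairs by \<open>d = gcd(x,c)\<close> and summing over
  \<open>y\<close> expresses \<open>T(m,n,k;c)\<close> as the sum of \<open>d S(m, nk/d\<^sup>2; c/d)\<close> over \<open>d | (n,k,c)\<close>.
  For \<open>k = 1\<close> this sum is \<open>S(m,n;c)\<close>, and the symmetry \<open>T(m,n,1;c) = T(1,n,m;c)\<close> is the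
  theorem.
\<close>

section \<open>Additive characters modulo \<open>c\<close>\<close>

lemma e2pi_add: "e2pi (x + y) = e2pi x * e2pi y"
  by (simp add: e2pi_def ring_distribs exp_add)

lemma e2pi_eq_1_iff: "e2pi x = 1 \<longleftrightarrow> x \<in> \<int>"
proof -
  have "e2pi x = cis (2 * pi * x)"
    by (simp add: e2pi_def cis_conv_exp mult_ac)
  moreover have "cis t = 1 \<longleftrightarrow> cos t = 1" for t
    by (auto simp: complex_eq_iff intro: cos_one_sin_zero)
  ultimately show ?thesis
    by (auto simp: cos_one_2pi_int Ints_def)
qed

lemma e2pi_of_int [simp]: "e2pi (of_int k) = 1"
  by (simp add: e2pi_eq_1_iff)

lemma e2pi_power: "e2pi x ^ k = e2pi (of_nat k * x)"
  by (simp add: e2pi_def exp_of_nat_mult [symmetric] mult_ac)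

lemma e2pi_cong:
  fixes a b c :: int
  assumes "[a = b] (mod c)"
  shows "e2pi (of_int a / of_int c) = e2pi (of_int b / of_int c)"
proof (cases "c = 0")
  case False
  from assms obtain k where "a = b + k * c"
    by (metis cong_iff_lin cong_sym mult.commute)
  with False have "of_int a / of_int c = of_int b / of_int c + (of_int k :: real)"
    by (simp add: field_simps)
  then show ?thesis
    by (simp add: e2pi_add)
qed simp

lemma of_int_div_in_Ints_iff:
  fixes a c :: int
  assumes "c \<noteq> 0"
  shows "(of_int a / of_int c :: real) \<in> \<int> \<longleftrightarrow> c dvd a"
proof
  assume "(of_int a / of_int c :: real) \<in> \<int>"
  then obtain k where "(of_int a / of_int c :: real) = of_int k"
    by (auto elim: Ints_cases)
  with assms have "(of_int a :: real) = of_int (c * k)"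
    by (simp add: field_simps)
  then show "c dvd a"
    by (simp only: of_int_eq_iff) simp
qed (use assms in auto)

text \<open>Orthogonality of additive characters: a geometric sum whose ratio \<open>w\<close> is a
  \<open>c\<close>-th root of unity, equal to 1 exactly when \<open>c\<close> divides
  \<open>a\<close>.\<close>

lemma sum_e2pi:
  fixes a c :: int
  assumes "c > 0"
  shows "(\<Sum>t\<in>{0..<c}. e2pi (of_int (t * a) / of_int c)) = (if c dvd a then of_int c else 0)"
proof -
  define w where "w = e2pi (of_int a / of_int c)"
  have "(\<Sum>t\<in>{0..<c}. e2pi (of_int (t * a) / of_int c)) = (\<Sum>i<nat c. w ^ i)"
    by (rule sum.reindex_bij_witness[of _ int nat])
       (use assms in \<open>auto simp: w_def e2pi_power\<close>)
  also have "\<dots> = (if c dvd a then of_int c else 0)"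
  proof (cases "c dvd a")
    case True
    then have "w = 1"
      using assms by (simp add: w_def e2pi_eq_1_iff of_int_div_in_Ints_iff)
    then show ?thesis
      using True assms by simp
  next
    case False
    then have "w \<noteq> 1"
      using assms by (simp add: w_def e2pi_eq_1_iff of_int_div_in_Ints_iff)
    moreover have "w ^ nat c = 1"
      using assms by (simp add: w_def e2pi_power)
    ultimately show ?thesis
      using False by (simp add: geometric_sum)
  qed
  finally show ?thesis .
qed

section \<open>The sum over a modular hyperbola and its symmetries\<close>

text \<open>This is T(m,n,k;c) of the overview.\<close>

definition hyperbola_sum :: "int \<Rightarrow> int \<Rightarrow> int \<Rightarrow> int \<Rightarrow> complex" where
  "hyperbola_sum m n k c =
     (\<Sum>x\<in>{0..<c}. \<Sum>y | y \<in> {0..<c} \<and> [x * y = k] (mod c).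
        e2pi (of_int (m * x + n * y) / of_int c))"

lemma hyperbola_sum_swap12: "hyperbola_sum m n k c = hyperbola_sum n m k c"
  unfolding hyperbola_sum_def
  by (subst sum.swap_restrict) (simp_all add: mult.commute add.commute)

text \<open>The terms in \<open>t\<close> combine to \<open>t * (k - x * y)\<close>, so by
  orthogonality the sum over \<open>t\<close> is \<open>c\<close> on the hyperbola and 0 off
  it.\<close>

lemma hyperbola_sum_eq_triple_sum:
  assumes "c > 0"
  shows "of_int c * hyperbola_sum m n k c =
    (\<Sum>x\<in>{0..<c}. \<Sum>y\<in>{0..<c}. \<Sum>t\<in>{0..<c}.
       e2pi (of_int (m * x + n * y + k * t - t * x * y) / of_int c))"
proof -
  have "(\<Sum>t\<in>{0..<c}. e2pi (of_int (m * x + n * y + k * t - t * x * y) / of_int c)) =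
      (if [x * y = k] (mod c) then of_int c * e2pi (of_int (m * x + n * y) / of_int c) else 0)"
    for x y
  proof -
    have "(\<Sum>t\<in>{0..<c}. e2pi (of_int (m * x + n * y + k * t - t * x * y) / of_int c)) =
        (\<Sum>t\<in>{0..<c}. e2pi (of_int (m * x + n * y) / of_int c) *
           e2pi (of_int (t * (k - x * y)) / of_int c))"
      by (intro sum.cong refl, subst e2pi_add [symmetric])
         (simp add: add_divide_distrib [symmetric] algebra_simps)
    also have "\<dots> = e2pi (of_int (m * x + n * y) / of_int c) *
        (if c dvd k - x * y then of_int c else 0)"
      using assms by (simp only: sum_distrib_left [symmetric] sum_e2pi)
    also have "c dvd k - x * y \<longleftrightarrow> [x * y = k] (mod c)"
      by (metis cong_iff_dvd_diff cong_sym)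
    finally show ?thesis
      by auto
  qed
  then show ?thesis
    unfolding hyperbola_sum_def sum_distrib_left
    by (simp only: sum.inter_filter finite_atLeastLessThan_int)
qed

text \<open>In the triple sum \<open>y\<close> and \<open>t\<close> enter alike: exchanging them
  preserves \<open>t * x * y\<close> and swaps the coefficients \<open>n\<close> and
  \<open>k\<close>. The factor \<open>c\<close> is then cancelled.\<close>

lemma hyperbola_sum_swap23:
  assumes "c > 0"
  shows "hyperbola_sum m n k c = hyperbola_sum m k n c"
proof -
  have "of_int c * hyperbola_sum m n k c = of_int c * hyperbola_sum m k n c"
    unfolding hyperbola_sum_eq_triple_sum[OF assms]
    by (rule sum.cong[OF refl], subst sum.swap) (simp add: algebra_simps)
  with assms show ?thesis
    by simp
qed

section \<open>Evaluation in terms of Kloosterman sums\<close>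

text \<open>A residue \<open>x\<close> with \<open>gcd x c = d\<close> is \<open>d * a\<close> for a
  unique \<open>a\<close> modulo \<open>c div d\<close>, and this \<open>a\<close> is coprime to
  \<open>c div d\<close>. The residue 0 belongs to \<open>d = c\<close>, where \<open>a = 0\<close>
  is the only class.\<close>

lemma sum_residues_by_gcd:
  fixes c :: int and f :: "int \<Rightarrow> 'a :: comm_monoid_add"
  assumes "c > 0"
  shows "(\<Sum>x\<in>{0..<c}. f x) =
    (\<Sum>d | d > 0 \<and> d dvd c. \<Sum>a | a \<in> {0..<c div d} \<and> coprime a (c div d). f (d * a))"
proof -
  have fin: "finite {d. d > 0 \<and> d dvd c}"
    using assms
    by (intro finite_subset[OF _ finite_atLeastAtMost_int[of 0 c]]) (auto dest: zdvd_imp_le)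
  have "(\<Sum>x\<in>{0..<c}. f x) =
      (\<Sum>d | d > 0 \<and> d dvd c. \<Sum>x | x \<in> {0..<c} \<and> gcd x c = d. f x)"
    using assms fin by (intro sum.group [symmetric]) auto
  also have "\<dots> =
      (\<Sum>d | d > 0 \<and> d dvd c. \<Sum>a | a \<in> {0..<c div d} \<and> coprime a (c div d). f (d * a))"
  proof (rule sum.cong[OF refl])
    fix d assume "d \<in> {d. d > 0 \<and> d dvd c}"
    then obtain q where d: "d > 0" and c: "c = d * q"
      by (auto elim: dvdE)
    have q: "c div d = q"
      using d c by simp
    have coprime_q: "coprime (x div d) q" if "gcd x c = d" for x
    proof -
      have "coprime (x div gcd x c) (c div gcd x c)"
        using assms by (intro div_gcd_coprime) simp
      then show ?thesis
        by (simp only: that q)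
    qed
    show "(\<Sum>x | x \<in> {0..<c} \<and> gcd x c = d. f x) =
        (\<Sum>a | a \<in> {0..<c div d} \<and> coprime a (c div d). f (d * a))"
      unfolding q
    proof (rule sum.reindex_bij_witness[of _ "\<lambda>a. d * a" "\<lambda>x. x div d"])
      fix x assume "x \<in> {x. x \<in> {0..<c} \<and> gcd x c = d}"
      then have x: "0 \<le> x" "x < c" "gcd x c = d"
        by auto
      then have dx: "d dvd x"
        by auto
      then show eq: "d * (x div d) = x"
        by simp
      have "d * (x div d) < d * q"
        using x(2) c eq by argo
      then show "x div d \<in> {a. a \<in> {0..<q} \<and> coprime a q}"
        using x(1) d coprime_q[OF x(3)] by (simp add: pos_imp_zdiv_nonneg_iff)
      show "f (d * (x div d)) = f x"
        by (simp add: eq)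
    next
      fix a assume "a \<in> {a. a \<in> {0..<q} \<and> coprime a q}"
      then show "d * a div d = a" "d * a \<in> {x. x \<in> {0..<c} \<and> gcd x c = d}"
        using d by (auto simp: c gcd_mult_left)
    qed
  qed
  finally show ?thesis .
qed

lemma sum_e2pi_progression:
  fixes d q r n :: int
  assumes "d > 0" "q > 0"
  shows "(\<Sum>y | y \<in> {0..<d * q} \<and> [y = r] (mod q). e2pi (of_int (n * y) / of_int (d * q))) =
    (if d dvd n then of_int d * e2pi (of_int (n div d * r) / of_int q) else 0)"
proof -
  \<comment> \<open>With the least residue \<open>s\<close> in place of \<open>r\<close>, the
    \<open>y\<close> in range are exactly \<open>s + t * q\<close> for \<open>0 \<le> t < d\<close>.
    The factor depending on \<open>t\<close> is then a character modulo \<open>d\<close>.\<close>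
  define s where "s = r mod q"
  have s: "0 \<le> s" "s < q" "[s = r] (mod q)"
    using assms by (auto simp: s_def)
  have "(\<Sum>y | y \<in> {0..<d * q} \<and> [y = r] (mod q). e2pi (of_int (n * y) / of_int (d * q))) =
      (\<Sum>t\<in>{0..<d}. e2pi (of_int (n * (s + t * q)) / of_int (d * q)))"
  proof (rule sum.reindex_bij_witness[of _ "\<lambda>t. s + t * q" "\<lambda>y. y div q"])
    fix y assume "y \<in> {y. y \<in> {0..<d * q} \<and> [y = r] (mod q)}"
    then have y: "0 \<le> y" "y < d * q" "y mod q = s"
      by (auto simp: s_def cong_def)
    then show eq: "s + y div q * q = y"
      using mod_div_mult_eq[of y q] by simp
    have "y div q * q < d * q"
      using eq y s by linarith
    then show "y div q \<in> {0..<d}"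
      using y assms by (simp add: pos_imp_zdiv_nonneg_iff)
    show "e2pi (of_int (n * (s + y div q * q)) / of_int (d * q)) =
        e2pi (of_int (n * y) / of_int (d * q))"
      by (simp only: eq)
  next
    fix t assume t: "t \<in> {0..<d}"
    show "(s + t * q) div q = t"
      using s assms by simp
    have "s + t * q < (t + 1) * q"
      using s by (simp add: algebra_simps)
    also have "\<dots> \<le> d * q"
      using t assms by (intro mult_right_mono) auto
    finally show "s + t * q \<in> {y. y \<in> {0..<d * q} \<and> [y = r] (mod q)}"
      using s t assms by (auto simp: cong_def)
  qed
  also have "\<dots> = (\<Sum>t\<in>{0..<d}. e2pi (of_int (n * s) / of_int (d * q)) *
      e2pi (of_int (t * n) / of_int d))"
    by (intro sum.cong refl, subst e2pi_add [symmetric], rule arg_cong[of _ _ e2pi])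
       (use assms in \<open>simp add: field_simps\<close>)
  also have "\<dots> = e2pi (of_int (n * s) / of_int (d * q)) * (if d dvd n then of_int d else 0)"
    using assms by (simp only: sum_distrib_left [symmetric] sum_e2pi)
  also have "\<dots> = (if d dvd n then of_int d * e2pi (of_int (n div d * r) / of_int q) else 0)"
  proof (cases "d dvd n")
    case True
    then obtain n' where n: "n = d * n'" ..
    have "e2pi (of_int (n * s) / of_int (d * q)) = e2pi (of_int (n' * s) / of_int q)"
      using assms by (simp add: n)
    \<comment> \<open>Once \<open>d\<close> is cancelled, only the class of \<open>s\<close> modulo
      \<open>q\<close> matters, so \<open>r\<close> may return.\<close>
    also have "\<dots> = e2pi (of_int (n' * r) / of_int q)"
      using s by (intro e2pi_cong cong_mult cong_refl)
    finally show ?thesis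
      using assms by (simp add: n)
  qed simp
  finally show ?thesis .
qed

lemma cong_mult_left_iff_modular_inverse:
  fixes a y k q :: int
  assumes "coprime a q"
  shows "[a * y = k] (mod q) \<longleftrightarrow> [y = k * modular_inverse q a] (mod q)"
proof -
  have inv: "[a * modular_inverse q a = 1] (mod q)"
    using assms by (rule cong_modular_inverse1)
  show ?thesis
  proof
    assume "[a * y = k] (mod q)"
    then have "[a * y * modular_inverse q a = k * modular_inverse q a] (mod q)"
      by (intro cong_mult cong_refl)
    moreover have "[a * modular_inverse q a * y = 1 * y] (mod q)"
      using inv by (intro cong_mult cong_refl)
    ultimately show "[y = k * modular_inverse q a] (mod q)"
      by (simp add: cong_def mult_ac)
  next
    assume "[y = k * modular_inverse q a] (mod q)"
    then have "[a * y = a * (k * modular_inverse q a)] (mod q)"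
      by (intro cong_mult cong_refl)
    moreover have "[a * modular_inverse q a * k = 1 * k] (mod q)"
      using inv by (intro cong_mult cong_refl)
    ultimately show "[a * y = k] (mod q)"
      by (simp add: cong_def mult_ac)
  qed
qed

text \<open>For \<open>x = d * a\<close> the congruence restricts \<open>y\<close> to one
  progression modulo \<open>c div d\<close>, whose direction is the inverse of \<open>a\<close>.
  Summing over \<open>y\<close> forces \<open>d dvd n\<close> and yields the factor
  \<open>d\<close>; the sum over \<open>a\<close> that remains is a Kloosterman sum.\<close>

lemma hyperbola_sum_eq_kloosterman_sum:
  assumes "c > 0"
  shows "hyperbola_sum m n k c =
    (\<Sum>d | d > 0 \<and> d dvd gcd n (gcd k c).
       of_int d * kloosterman m (n * k div d ^ 2) (c div d))"
proof -
  let ?inner = "\<lambda>x. \<Sum>y | y \<in> {0..<c} \<and> [x * y = k] (mod c).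
    e2pi (of_int (m * x + n * y) / of_int c)"
  have fin: "finite {d. d > 0 \<and> d dvd c}"
    using assms
    by (intro finite_subset[OF _ finite_atLeastAtMost_int[of 0 c]]) (auto dest: zdvd_imp_le)
  have inner: "(\<Sum>a | a \<in> {0..<c div d} \<and> coprime a (c div d). ?inner (d * a)) =
      (if d dvd n \<and> d dvd k then of_int d * kloosterman m (n * k div d ^ 2) (c div d) else 0)"
    if "d > 0" "d dvd c" for d
  proof (cases "d dvd k")
    \<comment> \<open>Here \<open>d\<close> divides both \<open>c\<close> and
      \<open>d * a * y\<close>, so the congruence would force \<open>d dvd k\<close>.\<close>
    case False
    have "{y. y \<in> {0..<c} \<and> [d * a * y = k] (mod c)} = {}" for a
    proof -
      have "d dvd k" if "[d * a * y = k] (mod c)" for y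
        using cong_dvd_iff[OF cong_dvd_modulus[OF that \<open>d dvd c\<close>]] by (simp add: mult.assoc)
      with False show ?thesis
        by blast
    qed
    with False show ?thesis
      by (simp only: sum.empty) simp
  next
    case True
    then obtain k' where k: "k = d * k'" ..
    from that obtain q where c: "c = d * q"
      by (auto elim: dvdE)
    have q: "q > 0" "c div d = q"
      using assms that c by (auto simp: zero_less_mult_iff)
    have "?inner (d * a) = (if d dvd n then of_int d *
        e2pi (of_int (m * a + n * k div d ^ 2 * modular_inverse q a) / of_int q) else 0)"
      if a: "coprime a q" for a
    proof -
      have "[d * a * y = k] (mod c) \<longleftrightarrow> [y = k' * modular_inverse q a] (mod q)" for y
      proof -
        \<comment> \<open>The common factor \<open>d\<close> is cancelled from both sides and from
          the modulus.\<close>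
        have "[d * a * y = k] (mod c) \<longleftrightarrow> [a * y = k'] (mod q)"
          using \<open>d > 0\<close> by (simp add: k c cong_def mult.assoc)
        with a show ?thesis
          by (simp add: cong_mult_left_iff_modular_inverse)
      qed
      moreover have "e2pi (of_int (m * (d * a) + n * y) / of_int c) =
          e2pi (of_int (m * a) / of_int q) * e2pi (of_int (n * y) / of_int (d * q))" for y
        using \<open>d > 0\<close> q
        by (subst e2pi_add [symmetric], intro arg_cong[of _ _ e2pi]) (simp add: c field_simps)
      ultimately have "?inner (d * a) =
          (\<Sum>y | y \<in> {0..<d * q} \<and> [y = k' * modular_inverse q a] (mod q).
             e2pi (of_int (m * a) / of_int q) * e2pi (of_int (n * y) / of_int (d * q)))"
        by (simp only: c)
      also have "\<dots> = e2pi (of_int (m * a) / of_int q) * (if d dvd n then of_int d *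
          e2pi (of_int (n div d * (k' * modular_inverse q a)) / of_int q) else 0)"
        using \<open>d > 0\<close> q by (simp only: sum_distrib_left [symmetric] sum_e2pi_progression)
      also have "\<dots> = (if d dvd n then of_int d *
          e2pi (of_int (m * a + n * k div d ^ 2 * modular_inverse q a) / of_int q) else 0)"
      proof (cases "d dvd n")
        case True
        then obtain n' where "n = d * n'" ..
        then show ?thesis
          using \<open>d > 0\<close>
          by (simp add: k power2_eq_square add_divide_distrib e2pi_add mult_ac)
      qed simp
      finally show ?thesis .
    qed
    then show ?thesis
      using True by (simp add: q kloosterman_def sum_distrib_left)
  qed
  have "hyperbola_sum m n k c = (\<Sum>d | d > 0 \<and> d dvd c.
      if d dvd n \<and> d dvd k then of_int d * kloosterman m (n * k div d ^ 2) (c div d) else 0)"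
    unfolding hyperbola_sum_def sum_residues_by_gcd[OF assms]
    by (rule sum.cong[OF refl], rule inner) auto
  also have "\<dots> = (\<Sum>d | d \<in> {d. d > 0 \<and> d dvd c} \<and> d dvd n \<and> d dvd k.
      of_int d * kloosterman m (n * k div d ^ 2) (c div d))"
    using fin by (rule sum.inter_filter [symmetric])
  also have "{d. d \<in> {d. d > 0 \<and> d dvd c} \<and> d dvd n \<and> d dvd k} =
      {d. d > 0 \<and> d dvd gcd n (gcd k c)}"
    by auto
  finally show ?thesis .
qed

section \<open>The case \<open>k = 1\<close> and the divisor-sum identity\<close>

lemma hyperbola_sum_1_eq_kloosterman:
  assumes "c > 0"
  shows "hyperbola_sum m n 1 c = kloosterman m n c"
proof -
  have "{d. d > 0 \<and> d dvd gcd n (gcd 1 c)} = {1 :: int}"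
    by auto
  then show ?thesis
    by (simp add: hyperbola_sum_eq_kloosterman_sum[OF assms])
qed

lemma kloosterman_commute:
  assumes "c > 0"
  shows "kloosterman m n c = kloosterman n m c"
  using hyperbola_sum_swap12[of m n 1 c]
  by (simp add: hyperbola_sum_1_eq_kloosterman[OF assms])

theorem mainTheorem1:
  fixes m n c :: int
  assumes "c \<ge> 1"
  shows "kloosterman m n c =
           (\<Sum>d | d > 0 \<and> d dvd gcd m (gcd n c).
              of_int d * kloosterman (m * n div d ^ 2) 1 (c div d))"
proof -
  have c: "c > 0"
    using assms by simp
  \<comment> \<open>Starting from the order \<open>n\<close>, \<open>m\<close> makes an exchange of
    the first and third arguments end in \<open>hyperbola_sum 1 m n c\<close>, whose expansion runs
    over the divisors of \<open>gcd m (gcd n c)\<close>.\<close>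
  have "kloosterman m n c = hyperbola_sum n m 1 c"
    using c by (simp add: hyperbola_sum_1_eq_kloosterman kloosterman_commute)
  also have "\<dots> = hyperbola_sum 1 m n c"
    using c by (metis hyperbola_sum_swap12 hyperbola_sum_swap23)
  also have "\<dots> = (\<Sum>d | d > 0 \<and> d dvd gcd m (gcd n c).
      of_int d * kloosterman 1 (m * n div d ^ 2) (c div d))"
    using c by (rule hyperbola_sum_eq_kloosterman_sum)
  \<comment> \<open>The argument 1 stands in the first slot; symmetry of each Kloosterman sum moves
    it to the second.\<close>
  also have "\<dots> = (\<Sum>d | d > 0 \<and> d dvd gcd m (gcd n c).
      of_int d * kloosterman (m * n div d ^ 2) 1 (c div d))"
  proof (intro sum.cong refl)
    fix d assume "d \<in> {d. d > 0 \<and> d dvd gcd m (gcd n c)}"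
    then have "c div d > 0"
      using c by (auto elim: dvdE simp: zero_less_mult_iff)
    then show "of_int d * kloosterman 1 (m * n div d ^ 2) (c div d) =
        of_int d * kloosterman (m * n div d ^ 2) 1 (c div d)"
      by (simp add: kloosterman_commute)
  qed
  finally show ?thesis .
qed

end
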